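(* Let $S\equiv(S,\cdot,I,\lambda,\rho)$ be a partial semigroup, let $i,j\in I$, let $a\in S_{ji}$ be sandwich-regular, and let $b\in V(a)$. Then (i) $\operatorname{Reg}(S_{ij}^a)=P^a$ is a (regular) subsemigroup of $S_{ij}^a$; (ii) $\operatorname{Reg}(S_{ij}a,\cdot)=P^aa=P_2^aa$ is a (regular) subsemigroup of $(S_{ij}a,\cdot)$; (iii) $\operatorname{Reg}(aS_{ij},\cdot)=aP^a=aP_1^a$ is a (regular) subsemigroup of $(aS_{ij},\cdot)$; (iv) $(aS_{ij}a,\circledast)=aP^aa=aP_1^aa=aP_2^aa$ is a regular subsemigroup of $S_{ji}^b$.
   Context: A partial semigroup is a 5-tuple $(S,\cdot,I,\lambda,\rho)$ consisting of a class $S$, a partial binary operation $(x,y)\mapsto x\cdot y=xy$, a class $I$, and functions $\lambda,\rho:S\to I$ such that for all $x,y,z\in S$: (1) $xy$ is defined iff $x\rho=y\lambda$; (2) if $xy$ is defined then $(xy)\lambda=x\lambda$ and $(xy)\rho=y\rho$; (3) if $xy$ and $yz$ are defined then $(xy)z=x(yz)$; (4) for all $i,j\in I$, $S_{ij}=\{x\in S: x\lambda=i,\ x\rho=j\}$ is a set. $S$ is monoidal if for each $i\in I$ there is $e_i\in S_{ii}$ with $x e_{x\rho}=x=e_{x\lambda}x$ for all $x\in S$. $S^{(1)}$ denotes $S$ if $S$ is monoidal, and otherwise the monoidal partial semigroup obtained by adjoining identities $e_i$ ($i\in I$). Green's relations on $S$: $x\leq_{\mathscr R}y$ iff $x=yu$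 for some $u\in S^{(1)}$; $x\leq_{\mathscr L}y$ iff $x=uy$ for some $u\in S^{(1)}$; $\mathscr R$ and $\mathscr L$ are the equivalences induced by these preorders. For $x\in S$, $V(x)=\{y\in S: x=xyx,\ y=yxy\}$. $\operatorname{Reg}(S)=\{x\in S: x=xyx \text{ for some } y\in S\}$; likewise for semigroups. For $a\in S_{ji}$, the sandwich semigroup is $S_{ij}^a=(S_{ij},\star_a)$, where $x\star_a y=xay$ (and $S_{ji}^b=(S_{ji},\star_b)$ for $b\in S_{ij}$). $S_{ij}a$ and $aS_{ij}$ are semigroups under the operation of $S$. Put $P_1^a=\{x\in S_{ij}: xa\mathrel{\mathscr R}x\}$, $P_2^a=\{x\in S_{ij}: ax\mathrel{\mathscr L}x\}$, $P^a=P_1^a\cap P_2^a$ (relations taken in $S$); for a set $X\subseteq S_{ij}$, $Xa=\{xa:x\in X\}$, $aX=\{ax:x\in X\}$, $aXa=\{axa:x\in X\}$. A regular element $a\in S_{ji}$ is sandwich-regular if $aS_{ij}a\subseteq\operatorname{Reg}(S)$. For $b\in V(a)$, $\circledast$ is the restriction of $\star_b$ to $aS_{ij}a\subseteq S_{ji}$, so $axa\circledast aya=axaya$ (independent of $b\in V(a)$). *)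

theory Defs
  imports Main
begin

section \<open>Semigroups on a carrier set\<close>

record 'a sgrp =
  sg_carrier :: "'a set"
  sg_mult :: "'a \<Rightarrow> 'a \<Rightarrow> 'a"

definition semigroup_on :: "'a sgrp \<Rightarrow> bool" where
  "semigroup_on M \<longleftrightarrow>
     (\<forall>x\<in>sg_carrier M. \<forall>y\<in>sg_carrier M. sg_mult M x y \<in> sg_carrier M) \<and>
     (\<forall>x\<in>sg_carrier M. \<forall>y\<in>sg_carrier M. \<forall>z\<in>sg_carrier M.
        sg_mult M (sg_mult M x y) z = sg_mult M x (sg_mult M y z))"

definition sg_Reg :: "'a sgrp \<Rightarrow> 'a set" where
  "sg_Reg M = {x \<in> sg_carrier M. \<exists>y\<in>sg_carrier M. x = sg_mult M (sg_mult M x y) x}"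

definition regular_semigroup :: "'a sgrp \<Rightarrow> bool" where
  "regular_semigroup M \<longleftrightarrow> semigroup_on M \<and> sg_Reg M = sg_carrier M"

text \<open>The operation of a substructure is inherited; its values outside the new carrier are
  irrelevant.\<close>

definition sg_restrict :: "'a sgrp \<Rightarrow> 'a set \<Rightarrow> 'a sgrp" where
  "sg_restrict M T = M\<lparr>sg_carrier := T\<rparr>"

definition subsemigroup :: "'a set \<Rightarrow> 'a sgrp \<Rightarrow> bool" where
  "subsemigroup T M \<longleftrightarrow>
     semigroup_on M \<and> T \<subseteq> sg_carrier M \<and> T \<noteq> {} \<and> (\<forall>x\<in>T. \<forall>y\<in>T. sg_mult M x y \<in> T)"

text \<open>Regularity is that of \<open>T\<close> as a semigroup in its own right: the witnesses
  have to lie in \<open>T\<close>.\<close>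

definition regular_subsemigroup :: "'a set \<Rightarrow> 'a sgrp \<Rightarrow> bool" where
  "regular_subsemigroup T M \<longleftrightarrow> subsemigroup T M \<and> regular_semigroup (sg_restrict M T)"

section \<open>Partial semigroups\<close>

text \<open>The partial operation takes the value \<open>None\<close> where it is undefined.\<close>

record ('a, 'i) psgrp =
  ps_carrier :: "'a set"
  ps_index :: "'i set"
  ps_mult :: "'a \<Rightarrow> 'a \<Rightarrow> 'a option"
  ps_lam :: "'a \<Rightarrow> 'i"
  ps_rho :: "'a \<Rightarrow> 'i"

definition ps_hom :: "('a, 'i) psgrp \<Rightarrow> 'i \<Rightarrow> 'i \<Rightarrow> 'a set" where
  "ps_hom S i j = {x \<in> ps_carrier S. ps_lam S x = i \<and> ps_rho S x = j}"

text \<open>The carrier and the index collection are sets here rather than classes, so the requirement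
  that every \<^term>\<open>ps_hom S i j\<close> be a set holds by typing.\<close>

definition partial_semigroup :: "('a, 'i) psgrp \<Rightarrow> bool" where
  "partial_semigroup S \<longleftrightarrow>
     (\<forall>x\<in>ps_carrier S. ps_lam S x \<in> ps_index S \<and> ps_rho S x \<in> ps_index S) \<and>
     (\<forall>x\<in>ps_carrier S. \<forall>y\<in>ps_carrier S. ps_mult S x y \<noteq> None \<longleftrightarrow> ps_rho S x = ps_lam S y) \<and>
     (\<forall>x\<in>ps_carrier S. \<forall>y\<in>ps_carrier S. \<forall>p. ps_mult S x y = Some p \<longrightarrow>
        p \<in> ps_carrier S \<and> ps_lam S p = ps_lam S x \<and> ps_rho S p = ps_rho S y) \<and>
     (\<forall>x\<in>ps_carrier S. \<forall>y\<in>ps_carrier S. \<forall>z\<in>ps_carrier S. \<forall>p q.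
        ps_mult S x y = Some p \<and> ps_mult S y z = Some q \<longrightarrow> ps_mult S p z = ps_mult S x q)"

definition monoidal :: "('a, 'i) psgrp \<Rightarrow> bool" where
  "monoidal S \<longleftrightarrow>
     (\<exists>e. (\<forall>i\<in>ps_index S. e i \<in> ps_hom S i i) \<and>
          (\<forall>x\<in>ps_carrier S. ps_mult S x (e (ps_rho S x)) = Some x \<and>
                             ps_mult S (e (ps_lam S x)) x = Some x))"

text \<open>The partial semigroup \<open>S\<^sup>(\<^sup>1\<^sup>)\<close>: \<open>Inl x\<close> is the copy of \<open>x\<close>, and \<open>Inr i\<close> the
  adjoined identity at \<open>i\<close>, present only when \<open>S\<close> is not monoidal.\<close>

fun adjoin_mult :: "('a, 'i) psgrp \<Rightarrow> 'a + 'i \<Rightarrow> 'a + 'i \<Rightarrow> ('a + 'i) option" where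
  "adjoin_mult S (Inl x) (Inl y) = map_option Inl (ps_mult S x y)"
| "adjoin_mult S (Inl x) (Inr k) = (if ps_rho S x = k then Some (Inl x) else None)"
| "adjoin_mult S (Inr k) (Inl y) = (if k = ps_lam S y then Some (Inl y) else None)"
| "adjoin_mult S (Inr k) (Inr l) = (if k = l then Some (Inr k) else None)"

definition ps_one :: "('a, 'i) psgrp \<Rightarrow> ('a + 'i, 'i) psgrp" where
  "ps_one S =
     \<lparr> ps_carrier = Inl ` ps_carrier S \<union> (if monoidal S then {} else Inr ` ps_index S),
       ps_index = ps_index S,
       ps_mult = adjoin_mult S,
       ps_lam = case_sum (ps_lam S) id,
       ps_rho = case_sum (ps_rho S) id \<rparr>"

lemma partial_semigroup_ps_one:
  assumes "partial_semigroup S"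
  shows "partial_semigroup (ps_one S)"
proof -
  let ?C = "ps_carrier S" and ?m = "ps_mult S"
  have idx: "ps_lam S x \<in> ps_index S" "ps_rho S x \<in> ps_index S" if "x \<in> ?C" for x
    using assms that unfolding partial_semigroup_def by blast+
  have dom: "?m x y \<noteq> None \<longleftrightarrow> ps_rho S x = ps_lam S y" if "x \<in> ?C" "y \<in> ?C" for x y
    using assms that unfolding partial_semigroup_def by blast
  have prod: "p \<in> ?C" "ps_lam S p = ps_lam S x" "ps_rho S p = ps_rho S y"
    if "x \<in> ?C" "y \<in> ?C" "?m x y = Some p" for x y p
    using assms that unfolding partial_semigroup_def by blast+
  have assoc: "?m p z = ?m x q"
    if "x \<in> ?C" "y \<in> ?C" "z \<in> ?C" "?m x y = Some p" "?m y z = Some q" for x y z p q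
    using assms that unfolding partial_semigroup_def by blast
  let ?C' = "ps_carrier (ps_one S)"
  have sel: "ps_lam (ps_one S) = case_sum (ps_lam S) id" "ps_rho (ps_one S) = case_sum (ps_rho S) id"
    "ps_mult (ps_one S) = adjoin_mult S" "ps_index (ps_one S) = ps_index S"
    by (simp_all add: ps_one_def)
  have inl: "Inl x \<in> ?C' \<longleftrightarrow> x \<in> ?C" for x
    by (auto simp: ps_one_def)
  have inr: "k \<in> ps_index S" if "Inr k \<in> ?C'" for k
    using that by (auto simp: ps_one_def split: if_splits)
  show ?thesis
    unfolding partial_semigroup_def sel
  proof (intro conjI ballI allI impI)
    fix x assume "x \<in> ?C'"
    then show "case_sum (ps_lam S) id x \<in> ps_index S" "case_sum (ps_rho S) id x \<in> ps_index S"
      by (cases x; simp add: inl inr idx)+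
  next
    fix x y assume "x \<in> ?C'" "y \<in> ?C'"
    then show "(adjoin_mult S x y \<noteq> None) = (case_sum (ps_rho S) id x = case_sum (ps_lam S) id y)"
      by (cases x; cases y) (simp_all add: inl dom del: not_None_eq)
  next
    fix x y p assume xy: "x \<in> ?C'" "y \<in> ?C'" and p: "adjoin_mult S x y = Some p"
    have "p \<in> ?C' \<and>
      case_sum (ps_lam S) id p = case_sum (ps_lam S) id x \<and>
      case_sum (ps_rho S) id p = case_sum (ps_rho S) id y"
    proof (cases x; cases y)
      fix u v assume uv: "x = Inl u" "y = Inl v"
      then obtain r where "?m u v = Some r" "p = Inl r"
        using p by auto
      then show ?thesis
        using prod[of u v r] xy uv by (simp add: inl)
    qed (use xy p in \<open>auto split: if_splits\<close>)
    then show "p \<in> ?C'"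
      "case_sum (ps_lam S) id p = case_sum (ps_lam S) id x"
      "case_sum (ps_rho S) id p = case_sum (ps_rho S) id y"
      by blast+
  next
    fix x y z p q
    assume xyz: "x \<in> ?C'" "y \<in> ?C'" "z \<in> ?C'"
      and pq: "adjoin_mult S x y = Some p \<and> adjoin_mult S y z = Some q"
    show "adjoin_mult S p z = adjoin_mult S x q"
    proof (cases x; cases y; cases z)
      fix u v w assume uvw: "x = Inl u" "y = Inl v" "z = Inl w"
      then obtain r s where "?m u v = Some r" "p = Inl r" "?m v w = Some s" "q = Inl s"
        using pq by auto
      then show ?thesis
        using assoc[of u v w r s] xyz uvw by (simp add: inl)
    next
      fix k v w assume uvw: "x = Inr k" "y = Inl v" "z = Inl w"
      then obtain s where "?m v w = Some s" "p = Inl v" "q = Inl s" "k = ps_lam S v"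
        using pq by (auto split: if_splits)
      then show ?thesis
        using prod[of v w s] xyz uvw by (simp add: inl)
    next
      fix u v k assume uvw: "x = Inl u" "y = Inl v" "z = Inr k"
      then obtain r where "?m u v = Some r" "p = Inl r" "q = Inl v" "k = ps_rho S v"
        using pq by (auto split: if_splits)
      then show ?thesis
        using prod[of u v r] xyz uvw by (simp add: inl)
    qed (use pq in \<open>auto split: if_splits\<close>)
  qed
qed

lemma monoidal_ps_one: "monoidal (ps_one S)"
proof (cases "monoidal S")
  case True
  then obtain e where "\<forall>i\<in>ps_index S. e i \<in> ps_hom S i i"
    "\<forall>x\<in>ps_carrier S. ps_mult S x (e (ps_rho S x)) = Some x \<and> ps_mult S (e (ps_lam S x)) x = Some x"
    unfolding monoidal_def by blast
  with True show ?thesis unfolding monoidal_def[of "ps_one S"]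
    by (intro exI[of _ "Inl \<circ> e"]) (auto simp: ps_one_def ps_hom_def)
next
  case False
  then show ?thesis unfolding monoidal_def[of "ps_one S"]
    by (intro exI[of _ Inr]) (auto simp: ps_one_def ps_hom_def)
qed

section \<open>Green's relations and regularity\<close>

definition R_le :: "('a, 'i) psgrp \<Rightarrow> 'a \<Rightarrow> 'a \<Rightarrow> bool" where
  "R_le S x y \<longleftrightarrow> (\<exists>u\<in>ps_carrier (ps_one S). ps_mult (ps_one S) (Inl y) u = Some (Inl x))"

definition L_le :: "('a, 'i) psgrp \<Rightarrow> 'a \<Rightarrow> 'a \<Rightarrow> bool" where
  "L_le S x y \<longleftrightarrow> (\<exists>u\<in>ps_carrier (ps_one S). ps_mult (ps_one S) u (Inl y) = Some (Inl x))"

definition R_rel :: "('a, 'i) psgrp \<Rightarrow> 'a \<Rightarrow> 'a \<Rightarrow> bool" where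
  "R_rel S x y \<longleftrightarrow> R_le S x y \<and> R_le S y x"

definition L_rel :: "('a, 'i) psgrp \<Rightarrow> 'a \<Rightarrow> 'a \<Rightarrow> bool" where
  "L_rel S x y \<longleftrightarrow> L_le S x y \<and> L_le S y x"

text \<open>Triple products \<open>xyz = (xy)z\<close>, undefined as soon as one of the two products is.\<close>

definition ps_mult3 :: "('a, 'i) psgrp \<Rightarrow> 'a \<Rightarrow> 'a \<Rightarrow> 'a \<Rightarrow> 'a option" where
  "ps_mult3 S x y z = Option.bind (ps_mult S x y) (\<lambda>p. ps_mult S p z)"

definition ps_V :: "('a, 'i) psgrp \<Rightarrow> 'a \<Rightarrow> 'a set" where
  "ps_V S x = {y \<in> ps_carrier S. ps_mult3 S x y x = Some x \<and> ps_mult3 S y x y = Some y}"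

definition ps_Reg :: "('a, 'i) psgrp \<Rightarrow> 'a set" where
  "ps_Reg S = {x \<in> ps_carrier S. \<exists>y\<in>ps_carrier S. ps_mult3 S x y x = Some x}"

section \<open>Sandwich semigroups\<close>

definition mult_right :: "('a, 'i) psgrp \<Rightarrow> 'a set \<Rightarrow> 'a \<Rightarrow> 'a set" where
  "mult_right S X a = {y. \<exists>x\<in>X. ps_mult S x a = Some y}"

definition mult_left :: "('a, 'i) psgrp \<Rightarrow> 'a \<Rightarrow> 'a set \<Rightarrow> 'a set" where
  "mult_left S a X = {y. \<exists>x\<in>X. ps_mult S a x = Some y}"

definition mult_both :: "('a, 'i) psgrp \<Rightarrow> 'a \<Rightarrow> 'a set \<Rightarrow> 'a set" where
  "mult_both S a X = {y. \<exists>x\<in>X. ps_mult3 S a x a = Some y}"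

text \<open>The products under \<open>the\<close> below are defined on the intended carriers: for \<open>a\<close> in
  \<^term>\<open>ps_hom S j i\<close>, respectively for \<open>X\<close> inside some \<^term>\<open>ps_hom S k k\<close>
  (note \<open>S\<^sub>i\<^sub>ja \<subseteq> S\<^sub>i\<^sub>i\<close> and \<open>aS\<^sub>i\<^sub>j \<subseteq> S\<^sub>j\<^sub>j\<close>).\<close>

definition sandwich :: "('a, 'i) psgrp \<Rightarrow> 'i \<Rightarrow> 'i \<Rightarrow> 'a \<Rightarrow> 'a sgrp" where
  "sandwich S i j a =
     \<lparr> sg_carrier = ps_hom S i j, sg_mult = (\<lambda>x y. the (ps_mult3 S x a y)) \<rparr>"

definition ps_sgrp :: "('a, 'i) psgrp \<Rightarrow> 'a set \<Rightarrow> 'a sgrp" where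
  "ps_sgrp S X = \<lparr> sg_carrier = X, sg_mult = (\<lambda>x y. the (ps_mult S x y)) \<rparr>"

definition P1 :: "('a, 'i) psgrp \<Rightarrow> 'i \<Rightarrow> 'i \<Rightarrow> 'a \<Rightarrow> 'a set" where
  "P1 S i j a = {x \<in> ps_hom S i j. \<exists>y. ps_mult S x a = Some y \<and> R_rel S y x}"

definition P2 :: "('a, 'i) psgrp \<Rightarrow> 'i \<Rightarrow> 'i \<Rightarrow> 'a \<Rightarrow> 'a set" where
  "P2 S i j a = {x \<in> ps_hom S i j. \<exists>y. ps_mult S a x = Some y \<and> L_rel S y x}"

definition PP :: "('a, 'i) psgrp \<Rightarrow> 'i \<Rightarrow> 'i \<Rightarrow> 'a \<Rightarrow> 'a set" where
  "PP S i j a = P1 S i j a \<inter> P2 S i j a"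

definition sandwich_regular :: "('a, 'i) psgrp \<Rightarrow> 'i \<Rightarrow> 'i \<Rightarrow> 'a \<Rightarrow> bool" where
  "sandwich_regular S i j a \<longleftrightarrow>
     a \<in> ps_hom S j i \<and> a \<in> ps_Reg S \<and> mult_both S a (ps_hom S i j) \<subseteq> ps_Reg S"

text \<open>The semigroup \<open>(aS\<^sub>i\<^sub>ja, \<circledast>)\<close>, with \<open>\<circledast>\<close> the restriction of the sandwich operation
  given by \<open>b\<close>.\<close>

definition circ_sgrp :: "('a, 'i) psgrp \<Rightarrow> 'i \<Rightarrow> 'i \<Rightarrow> 'a \<Rightarrow> 'a \<Rightarrow> 'a sgrp" where
  "circ_sgrp S i j a b = sg_restrict (sandwich S j i b) (mult_both S a (ps_hom S i j))"

end

theory Submission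
  imports Defs
begin

text \<open>An adjoined identity can only witness \<open>x = (xa)u\<close> if \<open>i = j\<close> and \<open>xa = x\<close>, and then \<open>u = a\<close>
  works as well; so \<open>x \<in> P\<^sub>1\<close> just means \<open>x = xau\<close> for some \<open>u \<in> S\<^sub>i\<^sub>j\<close>, and dually \<open>x \<in> P\<^sub>2\<close> means
  \<open>x = vax\<close>. If both hold and \<open>axa = axawaxa\<close>, then \<open>x = v(axa)u = v(axawaxa)u = xawax\<close>. Hence \<open>P\<close> is
  the set of regular elements of the sandwich semigroup, and the two equations make it visibly closed
  under \<open>\<star>\<^sub>a\<close>. A regular \<open>xa = xayaxa\<close> equals \<open>za\<close> for \<open>z = xayax \<in> P\<close>, and every \<open>axa\<close> equals \<open>aza\<close>
  for \<open>z = baxab \<in> P\<close>.\<close>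

section \<open>Semigroups whose regular elements are closed under multiplication\<close>

lemma semigroup_on_restrict:
  assumes "subsemigroup T M"
  shows "semigroup_on (sg_restrict M T)"
  using assms unfolding subsemigroup_def semigroup_on_def sg_restrict_def
  by (simp add: subset_iff)

lemma regular_subsemigroupI:
  assumes "subsemigroup T M"
    and "\<And>x. x \<in> T \<Longrightarrow> \<exists>y\<in>T. x = sg_mult M (sg_mult M x y) x"
  shows "regular_subsemigroup T M"
  using assms semigroup_on_restrict[OF assms(1)]
  unfolding regular_subsemigroup_def regular_semigroup_def sg_Reg_def
  by (auto simp: sg_restrict_def)

text \<open>Closure alone makes \<open>sg_Reg M\<close> regular in its own right. If
  \<open>x = xyx\<close>, the witness \<open>y\<close> may lie outside \<open>sg_Reg M\<close>, but
  \<open>z = yxy\<close> satisfies both \<open>x = xzx\<close> and \<open>z = zxz\<close>; the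
  second equation makes \<open>z\<close> itself regular.\<close>

lemma regular_subsemigroup_Reg:
  assumes M: "semigroup_on M" and ne: "sg_Reg M \<noteq> {}"
    and closed: "\<And>x y. x \<in> sg_Reg M \<Longrightarrow> y \<in> sg_Reg M \<Longrightarrow> sg_mult M x y \<in> sg_Reg M"
  shows "regular_subsemigroup (sg_Reg M) M"
proof (rule regular_subsemigroupI)
  show "subsemigroup (sg_Reg M) M"
    unfolding subsemigroup_def using M ne closed by (auto simp: sg_Reg_def)
next
  fix x assume "x \<in> sg_Reg M"
  then obtain y where x: "x \<in> sg_carrier M" and y: "y \<in> sg_carrier M"
    and xyx: "sg_mult M (sg_mult M x y) x = x"
    by (auto simp: sg_Reg_def)
  have cl: "sg_mult M p q \<in> sg_carrier M" if "p \<in> sg_carrier M" "q \<in> sg_carrier M" for p q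
    using M that by (auto simp: semigroup_on_def)
  have as: "sg_mult M (sg_mult M p q) r = sg_mult M p (sg_mult M q r)"
    if "p \<in> sg_carrier M" "q \<in> sg_carrier M" "r \<in> sg_carrier M" for p q r
    using M that by (auto simp: semigroup_on_def)
  have xyx': "sg_mult M x (sg_mult M y x) = x"
    using xyx by (simp add: as x y)
  \<comment> \<open>Once products are bracketed to the right by \<open>as\<close>, an occurrence of
    \<open>xyx\<close> followed by \<open>t\<close> no longer matches \<open>xyx'\<close>; this is
    the form that does.\<close>
  have xyxt: "sg_mult M x (sg_mult M y (sg_mult M x t)) = sg_mult M x t"
    if "t \<in> sg_carrier M" for t
    using arg_cong[OF xyx', of "\<lambda>s. sg_mult M s t"] that by (simp add: as cl x y)
  let ?z = "sg_mult M y (sg_mult M x y)"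
  have "?z = sg_mult M (sg_mult M ?z x) ?z" "x = sg_mult M (sg_mult M x ?z) x"
    by (simp_all add: as cl x y xyxt xyx')
  moreover from this have "?z \<in> sg_Reg M"
    unfolding sg_Reg_def using x y cl by blast
  ultimately show "\<exists>y\<in>sg_Reg M. x = sg_mult M (sg_mult M x y) x"
    by blast
qed

section \<open>Sandwich-regular elements\<close>

locale sandwich_regular_element =
  fixes S :: "('a, 'i) psgrp" and i j :: 'i and a b :: 'a
  assumes ps: "partial_semigroup S"
    and sreg: "sandwich_regular S i j a"
    and bV: "b \<in> ps_V S a"
begin

section \<open>Composition as a total operation, with definedness tracked by indices\<close>

definition mul :: "'a \<Rightarrow> 'a \<Rightarrow> 'a" (infixr "\<cdot>" 70) where
  "x \<cdot> y = the (ps_mult S x y)"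

abbreviation H :: "'i \<Rightarrow> 'i \<Rightarrow> 'a set" where
  "H \<equiv> ps_hom S"

abbreviation P :: "'a set" where
  "P \<equiv> PP S i j a"

lemma mult_defined_iff:
  "x \<in> ps_carrier S \<Longrightarrow> y \<in> ps_carrier S \<Longrightarrow> ps_mult S x y \<noteq> None \<longleftrightarrow> ps_rho S x = ps_lam S y"
  using ps unfolding partial_semigroup_def by blast

text \<open>The bridge from the option-valued product to \<open>mul\<close>: from here on,
  definedness is a matching of indices that the simplifier can check.\<close>

lemma mult_eq_Some [simp]:
  assumes "x \<in> ps_carrier S" "y \<in> ps_carrier S" "ps_rho S x = ps_lam S y"
  shows "ps_mult S x y = Some (x \<cdot> y)"
  using mult_defined_iff[OF assms(1,2)] assms(3) by (auto simp: mul_def)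

lemma mult_SomeD:
  assumes "x \<in> ps_carrier S" "y \<in> ps_carrier S" "ps_mult S x y = Some p"
  shows "ps_rho S x = ps_lam S y" "p = x \<cdot> y"
    "p \<in> ps_carrier S" "ps_lam S p = ps_lam S x" "ps_rho S p = ps_rho S y"
proof -
  show "ps_rho S x = ps_lam S y" using mult_defined_iff[OF assms(1,2)] assms(3) by simp
  show "p = x \<cdot> y" using assms(3) by (simp add: mul_def)
  show "p \<in> ps_carrier S" "ps_lam S p = ps_lam S x" "ps_rho S p = ps_rho S y"
    using ps assms unfolding partial_semigroup_def by blast+
qed

lemma mul_closed [simp]:
  assumes "x \<in> ps_carrier S" "y \<in> ps_carrier S" "ps_rho S x = ps_lam S y"
  shows "x \<cdot> y \<in> ps_carrier S" "ps_lam S (x \<cdot> y) = ps_lam S x" "ps_rho S (x \<cdot> y) = ps_rho S y"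
  using mult_SomeD[OF assms(1,2) mult_eq_Some[OF assms]] by blast+

lemma mul_assoc:
  assumes "x \<in> ps_carrier S" "y \<in> ps_carrier S" "z \<in> ps_carrier S"
    and "ps_rho S x = ps_lam S y" "ps_rho S y = ps_lam S z"
  shows "(x \<cdot> y) \<cdot> z = x \<cdot> y \<cdot> z"
proof -
  have "ps_mult S (x \<cdot> y) z = ps_mult S x (y \<cdot> z)"
    using ps assms(1,2,3) mult_eq_Some[OF assms(1,2,4)] mult_eq_Some[OF assms(2,3,5)]
    unfolding partial_semigroup_def by blast
  then show ?thesis by (simp only: mul_def)
qed

lemma mult3_eq [simp]:
  assumes "x \<in> ps_carrier S" "y \<in> ps_carrier S" "z \<in> ps_carrier S"
    and "ps_rho S x = ps_lam S y" "ps_rho S y = ps_lam S z"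
  shows "ps_mult3 S x y z = Some (x \<cdot> y \<cdot> z)"
  using assms by (simp add: ps_mult3_def mul_assoc)

text \<open>Used to recover the indices of an unknown factor, such as \<open>b\<close> or a
  regularity witness, from the mere fact that a product containing it is defined.\<close>

lemma mult3_SomeD:
  assumes "x \<in> ps_carrier S" "y \<in> ps_carrier S" "z \<in> ps_carrier S" "ps_mult3 S x y z = Some p"
  shows "ps_rho S x = ps_lam S y" "ps_rho S y = ps_lam S z" "p = x \<cdot> y \<cdot> z"
proof -
  obtain q where q: "ps_mult S x y = Some q" "ps_mult S q z = Some p"
    using assms(4) by (auto simp: ps_mult3_def bind_eq_Some_conv)
  note 1 = mult_SomeD[OF assms(1,2) q(1)]
  note 2 = mult_SomeD[OF 1(3) assms(3) q(2)]
  show "ps_rho S x = ps_lam S y" "ps_rho S y = ps_lam S z" using 1 2 by simp_all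
  with assms show "p = x \<cdot> y \<cdot> z" by simp
qed

lemma homD:
  assumes "x \<in> H k l"
  shows "x \<in> ps_carrier S" "ps_lam S x = k" "ps_rho S x = l"
  using assms by (auto simp: ps_hom_def)

lemma mul_hom [intro]: "x \<in> H k l \<Longrightarrow> y \<in> H l m \<Longrightarrow> x \<cdot> y \<in> H k m"
  by (auto simp: ps_hom_def)

lemma a_hom: "a \<in> H j i"
  using sreg by (simp add: sandwich_regular_def)

text \<open>Since \<open>aba\<close> is defined, \<open>b\<close> composes with \<open>a\<close> on
  both sides, and this forces its indices to be \<open>i\<close> and \<open>j\<close>.\<close>

lemma b_hom: "b \<in> H i j" and aba: "a \<cdot> b \<cdot> a = a" and bab: "b \<cdot> a \<cdot> b = b"
proof -
  note a = homD[OF a_hom]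
  have b: "b \<in> ps_carrier S" "ps_mult3 S a b a = Some a" "ps_mult3 S b a b = Some b"
    using bV by (auto simp: ps_V_def)
  note 1 = mult3_SomeD[OF a(1) b(1) a(1) b(2)] and 2 = mult3_SomeD[OF b(1) a(1) b(1) b(3)]
  show "b \<in> H i j" using a b 1 by (simp add: ps_hom_def)
  show "a \<cdot> b \<cdot> a = a" "b \<cdot> a \<cdot> b = b" using 1 2 by simp_all
qed

text \<open>With these facts the simplifier discharges the composability conditions of
  \<open>mul_assoc\<close>; later proofs declare the same facts for their local elements.\<close>

lemmas [simp] = homD[OF a_hom] homD[OF b_hom]

text \<open>Sandwich-regularity of \<open>a\<close> supplies a witness \<open>w\<close> somewhere in
  \<open>S\<close>; definedness of \<open>(axa)w(axa)\<close> places it in \<open>H i j\<close>. The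
  inclusion of \<open>aS\<^sub>i\<^sub>ja\<close> in \<open>ps_Reg S\<close> enters every later
  argument through this lemma.\<close>

lemma sandwich_inverse:
  assumes "x \<in> H i j"
  obtains w where "w \<in> H i j" "a \<cdot> x \<cdot> a \<cdot> w \<cdot> a \<cdot> x \<cdot> a = a \<cdot> x \<cdot> a"
proof -
  note [simp] = homD[OF assms]
  have "ps_mult3 S a x a = Some (a \<cdot> x \<cdot> a)" by simp
  then have "a \<cdot> x \<cdot> a \<in> ps_Reg S"
    using sreg assms unfolding sandwich_regular_def mult_both_def by blast
  then obtain w where w: "w \<in> ps_carrier S"
    "ps_mult3 S (a \<cdot> x \<cdot> a) w (a \<cdot> x \<cdot> a) = Some (a \<cdot> x \<cdot> a)"
    by (auto simp: ps_Reg_def)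
  have axa: "a \<cdot> x \<cdot> a \<in> ps_carrier S" by simp
  note 1 = mult3_SomeD[OF axa w(1) axa w(2)]
  show ?thesis
    using 1 w(1) by (intro that[of w]) (simp_all add: ps_hom_def mul_assoc)
qed

section \<open>Membership in \<open>P1\<close>, \<open>P2\<close> and \<open>P\<close> by
  multipliers from \<open>H i j\<close>\<close>

lemma P1_iff: "x \<in> P1 S i j a \<longleftrightarrow> x \<in> H i j \<and> (\<exists>u\<in>H i j. x \<cdot> a \<cdot> u = x)"
proof
  assume "x \<in> P1 S i j a"
  then have x: "x \<in> H i j" and "R_le S x (x \<cdot> a)"
    unfolding P1_def R_rel_def by (auto simp: ps_hom_def)
  note [simp] = homD[OF x]
  from \<open>R_le S x (x \<cdot> a)\<close> obtain u where u: "u \<in> ps_carrier (ps_one S)"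
    "adjoin_mult S (Inl (x \<cdot> a)) u = Some (Inl x)"
    unfolding R_le_def by (auto simp: ps_one_def)
  have "\<exists>u\<in>H i j. x \<cdot> a \<cdot> u = x"
  proof (cases u)
    case (Inl v)
    then have v: "v \<in> ps_carrier S" "ps_mult S (x \<cdot> a) v = Some x"
      using u by (auto simp: ps_one_def split: if_splits)
    have xa: "x \<cdot> a \<in> ps_carrier S" by simp
    note 1 = mult_SomeD[OF xa v]
    then have "v \<in> H i j" using v by (simp add: ps_hom_def)
    moreover have "x \<cdot> a \<cdot> v = x" using 1 v by (simp add: mul_assoc)
    ultimately show ?thesis by blast
  next
    case (Inr k)
    then have xa: "x \<cdot> a = x" using u by (auto split: if_splits)
    \<comment> \<open>The right index of \<open>xa\<close> is \<open>i\<close> and that of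
      \<open>x\<close> is \<open>j\<close>, so \<open>xa = x\<close> identifies the two and puts
      \<open>a\<close> into \<open>H i j\<close>.\<close>
    moreover have "ps_rho S (x \<cdot> a) = i" by simp
    ultimately have "i = j" by simp
    then show ?thesis using a_hom xa mul_assoc[of x a a] by (intro bexI[of _ a]) auto
  qed
  with x show "x \<in> H i j \<and> (\<exists>u\<in>H i j. x \<cdot> a \<cdot> u = x)" by blast
next
  assume "x \<in> H i j \<and> (\<exists>u\<in>H i j. x \<cdot> a \<cdot> u = x)"
  then obtain u where x: "x \<in> H i j" and u: "u \<in> H i j" and e: "x \<cdot> a \<cdot> u = x" by blast
  note [simp] = homD[OF x] homD[OF u]
  have "R_le S x (x \<cdot> a)" unfolding R_le_def
    by (intro bexI[of _ "Inl u"]) (simp_all add: ps_one_def mul_assoc e)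
  \<comment> \<open>This half of the relation holds for every \<open>x\<close> in
    \<open>H i j\<close>, with \<open>a\<close> as multiplier; all the content lies in the other
    half.\<close>
  moreover have "R_le S (x \<cdot> a) x" unfolding R_le_def
    by (intro bexI[of _ "Inl a"]) (simp_all add: ps_one_def)
  ultimately show "x \<in> P1 S i j a" using x by (simp add: P1_def R_rel_def)
qed

lemma P2_iff: "x \<in> P2 S i j a \<longleftrightarrow> x \<in> H i j \<and> (\<exists>v\<in>H i j. v \<cdot> a \<cdot> x = x)"
proof
  assume "x \<in> P2 S i j a"
  then have x: "x \<in> H i j" and "L_le S x (a \<cdot> x)"
    unfolding P2_def L_rel_def by (auto simp: ps_hom_def)
  note [simp] = homD[OF x]
  from \<open>L_le S x (a \<cdot> x)\<close> obtain u where u: "u \<in> ps_carrier (ps_one S)"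
    "adjoin_mult S u (Inl (a \<cdot> x)) = Some (Inl x)"
    unfolding L_le_def by (auto simp: ps_one_def)
  have "\<exists>v\<in>H i j. v \<cdot> a \<cdot> x = x"
  proof (cases u)
    case (Inl v)
    then have v: "v \<in> ps_carrier S" "ps_mult S v (a \<cdot> x) = Some x"
      using u by (auto simp: ps_one_def split: if_splits)
    have ax: "a \<cdot> x \<in> ps_carrier S" by simp
    note 1 = mult_SomeD[OF v(1) ax v(2)]
    then have "v \<in> H i j" using v by (simp add: ps_hom_def)
    with 1(2)[symmetric] show ?thesis by blast
  next
    case (Inr k)
    then have ax: "a \<cdot> x = x" using u by (auto split: if_splits)
    moreover have "ps_lam S (a \<cdot> x) = j" by simp
    ultimately have "i = j" by simp
    then show ?thesis using a_hom ax by (intro bexI[of _ a]) auto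
  qed
  with x show "x \<in> H i j \<and> (\<exists>v\<in>H i j. v \<cdot> a \<cdot> x = x)" by blast
next
  assume "x \<in> H i j \<and> (\<exists>v\<in>H i j. v \<cdot> a \<cdot> x = x)"
  then obtain v where x: "x \<in> H i j" and v: "v \<in> H i j" and e: "v \<cdot> a \<cdot> x = x" by blast
  note [simp] = homD[OF x] homD[OF v]
  have "L_le S x (a \<cdot> x)" unfolding L_le_def
    by (intro bexI[of _ "Inl v"]) (simp_all add: ps_one_def e)
  moreover have "L_le S (a \<cdot> x) x" unfolding L_le_def
    by (intro bexI[of _ "Inl a"]) (simp_all add: ps_one_def)
  ultimately show "x \<in> P2 S i j a" using x by (simp add: P2_def L_rel_def)
qed

lemma P_I: "x \<in> H i j \<Longrightarrow> u \<in> H i j \<Longrightarrow> v \<in> H i j \<Longrightarrow> x \<cdot> a \<cdot> u = x \<Longrightarrow> v \<cdot> a \<cdot> x = x \<Longrightarrow> x \<in> P"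
  unfolding PP_def Int_iff P1_iff P2_iff by blast

lemma P_hom: "x \<in> P \<Longrightarrow> x \<in> H i j"
  by (simp add: PP_def P1_iff)

text \<open>A left multiplier of \<open>x\<close> and a right multiplier of \<open>y\<close> do the
  same job for \<open>xay\<close>.\<close>

lemma P_mul:
  assumes "x \<in> P" "y \<in> P"
  shows "x \<cdot> a \<cdot> y \<in> P"
proof -
  obtain v u where x: "x \<in> H i j" and v: "v \<in> H i j" "v \<cdot> a \<cdot> x = x"
    and y: "y \<in> H i j" and u: "u \<in> H i j" "y \<cdot> a \<cdot> u = y"
    using assms unfolding PP_def Int_iff P1_iff P2_iff by blast
  note [simp] = homD[OF x] homD[OF y] homD[OF u(1)] homD[OF v(1)]
  have "v \<cdot> a \<cdot> x \<cdot> a \<cdot> y = (v \<cdot> a \<cdot> x) \<cdot> a \<cdot> y" by (simp add: mul_assoc)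
  then show ?thesis
    using x y a_hom by (intro P_I[OF _ u(1) v(1)]) (auto simp: mul_assoc u(2) v(2))
qed

text \<open>Provides the non-emptiness that \<open>subsemigroup\<close> demands;
  \<open>bab = b\<close> gives both multiplier equations at once.\<close>

lemma b_P: "b \<in> P"
  by (rule P_I[OF b_hom b_hom b_hom]) (rule bab)+

text \<open>All products with \<open>a\<close> are defined for elements of \<open>H i j\<close>, so
  the relationally defined set is an honest image, and inclusions become monotonicity of
  images.\<close>

lemma mult_right_eq: "X \<subseteq> H i j \<Longrightarrow> mult_right S X a = (\<lambda>x. x \<cdot> a) ` X"
  unfolding mult_right_def by (auto 0 4 simp: ps_hom_def subset_iff)

lemma mult_left_eq: "X \<subseteq> H i j \<Longrightarrow> mult_left S a X = (\<lambda>x. a \<cdot> x) ` X"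
  unfolding mult_left_def by (auto 0 4 simp: ps_hom_def subset_iff)

lemma mult_both_eq: "X \<subseteq> H i j \<Longrightarrow> mult_both S a X = (\<lambda>x. a \<cdot> x \<cdot> a) ` X"
  unfolding mult_both_def by (auto 0 4 simp: ps_hom_def subset_iff)

lemma P_subsets: "P \<subseteq> P1 S i j a" "P \<subseteq> P2 S i j a" "P1 S i j a \<subseteq> H i j" "P2 S i j a \<subseteq> H i j"
    "P \<subseteq> H i j"
  by (auto simp: PP_def P1_iff P2_iff)

section \<open>Regular elements of the sandwich semigroup\<close>

lemma sandwich_mult:
  "x \<in> H i j \<Longrightarrow> y \<in> H i j \<Longrightarrow> sg_mult (sandwich S i j a) x y = x \<cdot> a \<cdot> y"
  by (simp add: sandwich_def ps_hom_def)

lemma semigroup_sandwich: "semigroup_on (sandwich S i j a)"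
  using a_hom unfolding semigroup_on_def
  by (auto simp: sandwich_def ps_hom_def mul_assoc)

lemma P_regular:
  assumes "x \<in> P"
  obtains w where "w \<in> H i j" "x \<cdot> a \<cdot> w \<cdot> a \<cdot> x = x"
proof -
  obtain u v where x: "x \<in> H i j" and u: "u \<in> H i j" "x \<cdot> a \<cdot> u = x"
    and v: "v \<in> H i j" "v \<cdot> a \<cdot> x = x"
    using assms unfolding PP_def Int_iff P1_iff P2_iff by blast
  obtain w where w: "w \<in> H i j" "a \<cdot> x \<cdot> a \<cdot> w \<cdot> a \<cdot> x \<cdot> a = a \<cdot> x \<cdot> a"
    using sandwich_inverse[OF x] .
  note [simp] = homD[OF x] homD[OF u(1)] homD[OF v(1)] homD[OF w(1)]
  have "x \<cdot> a \<cdot> w \<cdot> a \<cdot> x = (v \<cdot> a \<cdot> x) \<cdot> a \<cdot> w \<cdot> a \<cdot> (x \<cdot> a \<cdot> u)"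
    by (simp only: u v)
  also have "\<dots> = v \<cdot> (a \<cdot> x \<cdot> a \<cdot> w \<cdot> a \<cdot> x \<cdot> a) \<cdot> u"
    by (simp add: mul_assoc)
  also have "\<dots> = v \<cdot> a \<cdot> (x \<cdot> a \<cdot> u)"
    unfolding w(2) by (simp add: mul_assoc)
  also have "\<dots> = x" by (simp only: u v)
  finally show ?thesis using that w(1) by blast
qed

lemma Reg_sandwich: "sg_Reg (sandwich S i j a) = P"
proof (intro set_eqI iffI)
  fix x assume "x \<in> sg_Reg (sandwich S i j a)"
  then obtain y where x: "x \<in> H i j" and y: "y \<in> H i j" and e: "(x \<cdot> a \<cdot> y) \<cdot> a \<cdot> x = x"
    using a_hom unfolding sg_Reg_def by (auto simp: sandwich_def ps_hom_def)
  note [simp] = homD[OF x] homD[OF y]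
  \<comment> \<open>The two bracketings of \<open>xayax = x\<close> yield the two multipliers:
    \<open>yax\<close> on the right and \<open>xay\<close> on the left.\<close>
  have "x \<cdot> a \<cdot> (y \<cdot> a \<cdot> x) = x" using e by (simp add: mul_assoc)
  with e show "x \<in> P" using x y a_hom by (intro P_I[of _ "y \<cdot> a \<cdot> x" "x \<cdot> a \<cdot> y"]) auto
next
  fix x assume xP: "x \<in> P"
  obtain w where w: "w \<in> H i j" "x \<cdot> a \<cdot> w \<cdot> a \<cdot> x = x"
    using P_regular[OF xP] .
  note [simp] = homD[OF P_hom[OF xP]] homD[OF w(1)]
  show "x \<in> sg_Reg (sandwich S i j a)"
    unfolding sg_Reg_def using w P_hom[OF xP]
    by (auto simp: sandwich_def mul_assoc intro!: bexI[of _ w])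
qed

lemma regular_subsemigroup_sandwich: "regular_subsemigroup P (sandwich S i j a)"
proof -
  have "regular_subsemigroup (sg_Reg (sandwich S i j a)) (sandwich S i j a)"
    by (rule regular_subsemigroup_Reg[OF semigroup_sandwich])
      (use b_P in \<open>auto simp: Reg_sandwich sandwich_mult P_hom P_mul\<close>)
  then show ?thesis by (simp add: Reg_sandwich)
qed

section \<open>Regular elements of the one-sided semigroups \<open>S\<^sub>i\<^sub>ja\<close> and
  \<open>aS\<^sub>i\<^sub>j\<close>\<close>

lemma ps_sgrp_sel [simp]:
  "sg_carrier (ps_sgrp S X) = X" "sg_mult (ps_sgrp S X) x y = x \<cdot> y"
  by (simp_all add: ps_sgrp_def mul_def)

text \<open>Closure is \<open>(xa)(ya) = (xay)a\<close>: right multiplication by \<open>a\<close> is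
  a homomorphism from the sandwich semigroup.\<close>

lemma semigroup_right: "semigroup_on (ps_sgrp S (mult_right S (H i j) a))"
  unfolding semigroup_on_def
proof (intro conjI ballI)
  fix p q assume "p \<in> sg_carrier (ps_sgrp S (mult_right S (H i j) a))"
    "q \<in> sg_carrier (ps_sgrp S (mult_right S (H i j) a))"
  then obtain x y where xy: "x \<in> H i j" "y \<in> H i j" "p = x \<cdot> a" "q = y \<cdot> a"
    by (auto simp: mult_right_eq)
  note [simp] = homD[OF xy(1)] homD[OF xy(2)]
  show "sg_mult (ps_sgrp S (mult_right S (H i j) a)) p q
      \<in> sg_carrier (ps_sgrp S (mult_right S (H i j) a))"
    using xy a_hom
    by (auto simp: mult_right_eq mul_assoc intro!: image_eqI[of _ _ "x \<cdot> a \<cdot> y"])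
qed (auto simp: mult_right_eq mul_assoc ps_hom_def)

lemma semigroup_left: "semigroup_on (ps_sgrp S (mult_left S a (H i j)))"
  unfolding semigroup_on_def
proof (intro conjI ballI)
  fix p q assume "p \<in> sg_carrier (ps_sgrp S (mult_left S a (H i j)))"
    "q \<in> sg_carrier (ps_sgrp S (mult_left S a (H i j)))"
  then obtain x y where xy: "x \<in> H i j" "y \<in> H i j" "p = a \<cdot> x" "q = a \<cdot> y"
    by (auto simp: mult_left_eq)
  note [simp] = homD[OF xy(1)] homD[OF xy(2)]
  show "sg_mult (ps_sgrp S (mult_left S a (H i j))) p q
      \<in> sg_carrier (ps_sgrp S (mult_left S a (H i j)))"
    using xy a_hom
    by (auto simp: mult_left_eq mul_assoc intro!: image_eqI[of _ _ "x \<cdot> a \<cdot> y"])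
qed (auto simp: mult_left_eq mul_assoc ps_hom_def)

text \<open>If \<open>xa\<close> or \<open>ax\<close> is regular in its one-sided semigroup,
  \<open>x\<close> itself need not lie in \<open>P\<close>, but it can be replaced by
  \<open>xayax\<close>. The disjunction lets one lemma serve both sides.\<close>

lemma xayax_P:
  assumes x: "x \<in> H i j" and y: "y \<in> H i j"
    and e: "x \<cdot> a \<cdot> y \<cdot> a \<cdot> x \<cdot> a = x \<cdot> a \<or> a \<cdot> x \<cdot> a \<cdot> y \<cdot> a \<cdot> x = a \<cdot> x"
  shows "x \<cdot> a \<cdot> y \<cdot> a \<cdot> x \<in> P"
proof -
  note [simp] = homD[OF x] homD[OF y]
  let ?z = "x \<cdot> a \<cdot> y \<cdot> a \<cdot> x"
  \<comment> \<open>Both multiplier equations for \<open>?z\<close>, with \<open>yax\<close> on the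
    right and \<open>xay\<close> on the left, rebracket to this one.\<close>
  have z: "x \<cdot> a \<cdot> y \<cdot> a \<cdot> x \<cdot> a \<cdot> y \<cdot> a \<cdot> x = ?z"
  proof (rule disjE[OF e])
    assume e: "x \<cdot> a \<cdot> y \<cdot> a \<cdot> x \<cdot> a = x \<cdot> a"
    have "x \<cdot> a \<cdot> y \<cdot> a \<cdot> x \<cdot> a \<cdot> y \<cdot> a \<cdot> x = (x \<cdot> a \<cdot> y \<cdot> a \<cdot> x \<cdot> a) \<cdot> y \<cdot> a \<cdot> x"
      by (simp add: mul_assoc)
    then show ?thesis unfolding e by (simp add: mul_assoc)
  next
    assume e: "a \<cdot> x \<cdot> a \<cdot> y \<cdot> a \<cdot> x = a \<cdot> x"
    show ?thesis by (simp only: e)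
  qed
  show ?thesis
    using x y a_hom by (intro P_I[of _ "y \<cdot> a \<cdot> x" "x \<cdot> a \<cdot> y"]) (auto simp: mul_assoc z)
qed

text \<open>From \<open>x = vax\<close> follows
  \<open>xa = v(axa) = v(axawaxa) = (xa)(wa)(xa)\<close>. A left multiplier suffices because the
  final \<open>a\<close> needed to complete \<open>axa\<close> is already there.\<close>

lemma P2_right_Reg:
  "mult_right S (P2 S i j a) a \<subseteq> sg_Reg (ps_sgrp S (mult_right S (H i j) a))"
proof
  fix p assume "p \<in> mult_right S (P2 S i j a) a"
  then obtain x v where p: "p = x \<cdot> a" and x: "x \<in> H i j"
    and v: "v \<in> H i j" "v \<cdot> a \<cdot> x = x"
    by (auto simp: mult_right_eq P_subsets P2_iff)
  obtain w where w: "w \<in> H i j" "a \<cdot> x \<cdot> a \<cdot> w \<cdot> a \<cdot> x \<cdot> a = a \<cdot> x \<cdot> a"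
    using sandwich_inverse[OF x] .
  note [simp] = homD[OF x] homD[OF v(1)] homD[OF w(1)]
  have "x \<cdot> a = v \<cdot> a \<cdot> x \<cdot> a"
    using arg_cong[OF v(2), of "\<lambda>t. t \<cdot> a"] by (simp add: mul_assoc)
  also have "\<dots> = (v \<cdot> a \<cdot> x) \<cdot> a \<cdot> w \<cdot> a \<cdot> x \<cdot> a"
    using w(2) by (simp add: mul_assoc)
  finally have "x \<cdot> a = ((x \<cdot> a) \<cdot> w \<cdot> a) \<cdot> x \<cdot> a"
    by (simp add: v mul_assoc)
  then show "p \<in> sg_Reg (ps_sgrp S (mult_right S (H i j) a))"
    unfolding sg_Reg_def p using x w(1) by (auto simp: mult_right_eq)
qed

lemma P1_left_Reg:
  "mult_left S a (P1 S i j a) \<subseteq> sg_Reg (ps_sgrp S (mult_left S a (H i j)))"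
proof
  fix p assume "p \<in> mult_left S a (P1 S i j a)"
  then obtain x u where p: "p = a \<cdot> x" and x: "x \<in> H i j"
    and u: "u \<in> H i j" "x \<cdot> a \<cdot> u = x"
    by (auto simp: mult_left_eq P_subsets P1_iff)
  obtain w where w: "w \<in> H i j" "a \<cdot> x \<cdot> a \<cdot> w \<cdot> a \<cdot> x \<cdot> a = a \<cdot> x \<cdot> a"
    using sandwich_inverse[OF x] .
  note [simp] = homD[OF x] homD[OF u(1)] homD[OF w(1)]
  have "a \<cdot> x = (a \<cdot> x \<cdot> a) \<cdot> u"
    by (simp add: mul_assoc u)
  also have "\<dots> = (a \<cdot> x \<cdot> a \<cdot> w \<cdot> a \<cdot> x \<cdot> a) \<cdot> u"
    by (simp only: w)
  finally have "a \<cdot> x = ((a \<cdot> x) \<cdot> a \<cdot> w) \<cdot> a \<cdot> x"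
    by (simp add: mul_assoc u)
  then show "p \<in> sg_Reg (ps_sgrp S (mult_left S a (H i j)))"
    unfolding sg_Reg_def p using x w(1) by (auto simp: mult_left_eq)
qed

lemma Reg_right_P:
  "sg_Reg (ps_sgrp S (mult_right S (H i j) a)) \<subseteq> mult_right S P a"
proof
  fix p assume "p \<in> sg_Reg (ps_sgrp S (mult_right S (H i j) a))"
  then obtain x y where p: "p = x \<cdot> a" and x: "x \<in> H i j" and y: "y \<in> H i j"
    and e: "((x \<cdot> a) \<cdot> y \<cdot> a) \<cdot> x \<cdot> a = x \<cdot> a"
    unfolding sg_Reg_def by (auto simp: mult_right_eq)
  note [simp] = homD[OF x] homD[OF y]
  have e': "x \<cdot> a \<cdot> y \<cdot> a \<cdot> x \<cdot> a = x \<cdot> a" using e by (simp add: mul_assoc)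
  then have "x \<cdot> a \<cdot> y \<cdot> a \<cdot> x \<in> P" using xayax_P[OF x y] by blast
  then show "p \<in> mult_right S P a"
    unfolding p mult_right_eq[OF P_subsets(5)] by (rule rev_image_eqI) (simp add: mul_assoc e')
qed

lemma Reg_left_P:
  "sg_Reg (ps_sgrp S (mult_left S a (H i j))) \<subseteq> mult_left S a P"
proof
  fix p assume "p \<in> sg_Reg (ps_sgrp S (mult_left S a (H i j)))"
  then obtain x y where p: "p = a \<cdot> x" and x: "x \<in> H i j" and y: "y \<in> H i j"
    and e: "((a \<cdot> x) \<cdot> a \<cdot> y) \<cdot> a \<cdot> x = a \<cdot> x"
    unfolding sg_Reg_def by (auto simp: mult_left_eq)
  note [simp] = homD[OF x] homD[OF y]
  have e': "a \<cdot> x \<cdot> a \<cdot> y \<cdot> a \<cdot> x = a \<cdot> x" using e by (simp add: mul_assoc)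
  then have "x \<cdot> a \<cdot> y \<cdot> a \<cdot> x \<in> P" using xayax_P[OF x y] by blast
  then show "p \<in> mult_left S a P"
    unfolding p mult_left_eq[OF P_subsets(5)] by (rule rev_image_eqI) (simp add: e')
qed

text \<open>A cycle of inclusions: \<open>Pa\<close> in \<open>P2 a\<close>, \<open>P2 a\<close> in
  the regular elements, and these in \<open>Pa\<close>.\<close>

lemma Reg_right:
  "sg_Reg (ps_sgrp S (mult_right S (H i j) a)) = mult_right S P a"
  "mult_right S P a = mult_right S (P2 S i j a) a"
proof -
  have "mult_right S P a \<subseteq> mult_right S (P2 S i j a) a"
    unfolding mult_right_eq[OF P_subsets(5)] mult_right_eq[OF P_subsets(4)]
    using P_subsets(2) by (rule image_mono)
  then show "sg_Reg (ps_sgrp S (mult_right S (H i j) a)) = mult_right S P a"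
    "mult_right S P a = mult_right S (P2 S i j a) a"
    using P2_right_Reg Reg_right_P by blast+
qed

lemma Reg_left:
  "sg_Reg (ps_sgrp S (mult_left S a (H i j))) = mult_left S a P"
  "mult_left S a P = mult_left S a (P1 S i j a)"
proof -
  have "mult_left S a P \<subseteq> mult_left S a (P1 S i j a)"
    unfolding mult_left_eq[OF P_subsets(5)] mult_left_eq[OF P_subsets(3)]
    using P_subsets(1) by (rule image_mono)
  then show "sg_Reg (ps_sgrp S (mult_left S a (H i j))) = mult_left S a P"
    "mult_left S a P = mult_left S a (P1 S i j a)"
    using P1_left_Reg Reg_left_P by blast+
qed

text \<open>By \<open>(xa)(ya) = (xay)a\<close>, closure of \<open>Pa\<close> is inherited from
  closure of \<open>P\<close> in the sandwich semigroup; \<open>regular_subsemigroup_Reg\<close>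
  does the rest.\<close>

lemma regular_subsemigroup_right:
  "regular_subsemigroup (mult_right S P a) (ps_sgrp S (mult_right S (H i j) a))"
proof -
  let ?M = "ps_sgrp S (mult_right S (H i j) a)"
  have "sg_mult ?M (x \<cdot> a) (y \<cdot> a) \<in> sg_Reg ?M" if "x \<in> P" "y \<in> P" for x y
  proof -
    note [simp] = homD[OF P_hom[OF that(1)]] homD[OF P_hom[OF that(2)]]
    show ?thesis
      unfolding Reg_right(1) mult_right_eq[OF P_subsets(5)] using P_mul[OF that]
      by (rule rev_image_eqI) (simp add: mul_assoc)
  qed
  moreover have "sg_Reg ?M = (\<lambda>x. x \<cdot> a) ` P"
    by (simp add: Reg_right(1) mult_right_eq[OF P_subsets(5)])
  ultimately have "regular_subsemigroup (sg_Reg ?M) ?M"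
    using b_P by (intro regular_subsemigroup_Reg[OF semigroup_right]) auto
  then show ?thesis by (simp add: Reg_right(1))
qed

lemma regular_subsemigroup_left:
  "regular_subsemigroup (mult_left S a P) (ps_sgrp S (mult_left S a (H i j)))"
proof -
  let ?M = "ps_sgrp S (mult_left S a (H i j))"
  have "sg_mult ?M (a \<cdot> x) (a \<cdot> y) \<in> sg_Reg ?M" if "x \<in> P" "y \<in> P" for x y
  proof -
    note [simp] = homD[OF P_hom[OF that(1)]] homD[OF P_hom[OF that(2)]]
    show ?thesis
      unfolding Reg_left(1) mult_left_eq[OF P_subsets(5)] using P_mul[OF that]
      by (rule rev_image_eqI) (simp add: mul_assoc)
  qed
  moreover have "sg_Reg ?M = (\<lambda>x. a \<cdot> x) ` P"
    by (simp add: Reg_left(1) mult_left_eq[OF P_subsets(5)])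
  ultimately have "regular_subsemigroup (sg_Reg ?M) ?M"
    using b_P by (intro regular_subsemigroup_Reg[OF semigroup_left]) auto
  then show ?thesis by (simp add: Reg_left(1))
qed

section \<open>The semigroup on \<open>aS\<^sub>i\<^sub>ja\<close>\<close>

lemma aba_cancel:
  assumes "t \<in> ps_carrier S" "ps_lam S t = i"
  shows "a \<cdot> b \<cdot> a \<cdot> t = a \<cdot> t"
  \<comment> \<open>Multiplying by \<open>t\<close> gives the shape in which \<open>aba\<close>
    occurs inside products bracketed to the right.\<close>
  using arg_cong[OF aba, of "\<lambda>s. s \<cdot> t"] assms by (simp add: mul_assoc)

lemma bab_cancel:
  assumes "t \<in> ps_carrier S" "ps_lam S t = j"
  shows "b \<cdot> a \<cdot> b \<cdot> t = b \<cdot> t"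
  using arg_cong[OF bab, of "\<lambda>s. s \<cdot> t"] assms by (simp add: mul_assoc)

lemma aHa_subset_aPa: "mult_both S a (H i j) \<subseteq> mult_both S a P"
proof
  fix p assume "p \<in> mult_both S a (H i j)"
  then obtain x where x: "x \<in> H i j" and p: "p = a \<cdot> x \<cdot> a" by (auto simp: mult_both_eq)
  note [simp] = homD[OF x]
  \<comment> \<open>Because \<open>bab = b\<close>, the element \<open>b\<close> is both a left and
    a right multiplier of \<open>baxab\<close>.\<close>
  have "b \<cdot> a \<cdot> x \<cdot> a \<cdot> b \<in> P"
    using x a_hom b_hom by (intro P_I[of _ b b]) (auto simp: mul_assoc bab bab_cancel)
  then show "p \<in> mult_both S a P"
    unfolding p mult_both_eq[OF P_subsets(5)]
    by (rule rev_image_eqI) (simp add: mul_assoc aba aba_cancel)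
qed

text \<open>All four sets lie between \<open>aPa\<close> and \<open>aS\<^sub>i\<^sub>ja\<close>, and
  \<open>aHa_subset_aPa\<close> closes the gap.\<close>

lemma aPa_eq:
  "mult_both S a (H i j) = mult_both S a P"
  "mult_both S a P = mult_both S a (P1 S i j a)"
  "mult_both S a (P1 S i j a) = mult_both S a (P2 S i j a)"
  using aHa_subset_aPa P_subsets
  unfolding mult_both_eq[OF P_subsets(5)] mult_both_eq[OF P_subsets(4)]
    mult_both_eq[OF P_subsets(3)] mult_both_eq[OF order_refl]
  by blast+

lemma regular_subsemigroup_circ:
  "regular_subsemigroup (mult_both S a (H i j)) (sandwich S j i b)"
proof (rule regular_subsemigroupI)
  have m: "sg_mult (sandwich S j i b) p q = p \<cdot> b \<cdot> q" if "p \<in> H j i" "q \<in> H j i" for p q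
    using that by (simp add: sandwich_def ps_hom_def)
  have aHa: "a \<cdot> x \<cdot> a \<in> H j i" if "x \<in> H i j" for x
    using that a_hom by blast
  \<comment> \<open>Collapsing the middle \<open>aba\<close> shows that \<open>x\<close> maps to
    \<open>axa\<close> homomorphically, from the sandwich semigroup of \<open>a\<close> to that of
    \<open>b\<close>.\<close>
  have prod: "sg_mult (sandwich S j i b) (a \<cdot> x \<cdot> a) (a \<cdot> y \<cdot> a) = a \<cdot> (x \<cdot> a \<cdot> y) \<cdot> a"
    if x: "x \<in> H i j" and y: "y \<in> H i j" for x y
  proof -
    note [simp] = homD[OF x] homD[OF y]
    show ?thesis by (simp add: m aHa x y mul_assoc aba_cancel)
  qed
  show "subsemigroup (mult_both S a (H i j)) (sandwich S j i b)"
    unfolding subsemigroup_def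
  proof (intro conjI ballI)
    show "semigroup_on (sandwich S j i b)"
      using b_hom unfolding semigroup_on_def
      by (auto simp: sandwich_def ps_hom_def mul_assoc)
    show "mult_both S a (H i j) \<subseteq> sg_carrier (sandwich S j i b)"
      using aHa by (auto simp: mult_both_eq sandwich_def)
    show "mult_both S a (H i j) \<noteq> {}"
      using b_hom by (auto simp: mult_both_eq)
    fix p q assume "p \<in> mult_both S a (H i j)" "q \<in> mult_both S a (H i j)"
    then show "sg_mult (sandwich S j i b) p q \<in> mult_both S a (H i j)"
      using a_hom by (auto simp: mult_both_eq prod intro!: imageI intro: mul_hom[OF _ mul_hom])
  qed
  fix p assume "p \<in> mult_both S a (H i j)"
  then obtain x where x: "x \<in> H i j" and p: "p = a \<cdot> x \<cdot> a" by (auto simp: mult_both_eq)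
  obtain w where w: "w \<in> H i j" "a \<cdot> x \<cdot> a \<cdot> w \<cdot> a \<cdot> x \<cdot> a = a \<cdot> x \<cdot> a"
    using sandwich_inverse[OF x] .
  note [simp] = homD[OF x] homD[OF w(1)]
  have xaw: "x \<cdot> a \<cdot> w \<in> H i j" using x w a_hom by blast
  \<comment> \<open>The witness \<open>awa\<close> lies in \<open>aS\<^sub>i\<^sub>ja\<close>
    itself: two uses of \<open>prod\<close> reduce the triple product to \<open>axawaxa\<close>,
    which is \<open>axa\<close> by the choice of \<open>w\<close>.\<close>
  have "p = sg_mult (sandwich S j i b) (sg_mult (sandwich S j i b) p (a \<cdot> w \<cdot> a)) p"
    unfolding p prod[OF x w(1)] prod[OF xaw x] using w(2) by (simp add: mul_assoc)
  then show "\<exists>q\<in>mult_both S a (H i j).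
      p = sg_mult (sandwich S j i b) (sg_mult (sandwich S j i b) p q) p"
    using w(1) by (auto simp: mult_both_eq)
qed

end

theorem proposition2p5:
  fixes S :: "('a, 'i) psgrp" and i j :: 'i and a b :: 'a
  assumes "partial_semigroup S"
    and "i \<in> ps_index S" and "j \<in> ps_index S"
    and "a \<in> ps_hom S j i"
    and "sandwich_regular S i j a"
    and "b \<in> ps_V S a"
  shows
    "(sg_Reg (sandwich S i j a) = PP S i j a \<and>
      regular_subsemigroup (PP S i j a) (sandwich S i j a)) \<and>
     (sg_Reg (ps_sgrp S (mult_right S (ps_hom S i j) a)) = mult_right S (PP S i j a) a \<and>
      mult_right S (PP S i j a) a = mult_right S (P2 S i j a) a \<and>
      regular_subsemigroup (mult_right S (PP S i j a) a)
        (ps_sgrp S (mult_right S (ps_hom S i j) a))) \<and>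
     (sg_Reg (ps_sgrp S (mult_left S a (ps_hom S i j))) = mult_left S a (PP S i j a) \<and>
      mult_left S a (PP S i j a) = mult_left S a (P1 S i j a) \<and>
      regular_subsemigroup (mult_left S a (PP S i j a))
        (ps_sgrp S (mult_left S a (ps_hom S i j)))) \<and>
     (sg_carrier (circ_sgrp S i j a b) = mult_both S a (PP S i j a) \<and>
      mult_both S a (PP S i j a) = mult_both S a (P1 S i j a) \<and>
      mult_both S a (P1 S i j a) = mult_both S a (P2 S i j a) \<and>
      regular_subsemigroup (sg_carrier (circ_sgrp S i j a b)) (sandwich S j i b) \<and>
      regular_semigroup (circ_sgrp S i j a b))"
proof -
  interpret sandwich_regular_element S i j a b
    using assms by unfold_locales
  have circ: "sg_carrier (circ_sgrp S i j a b) = mult_both S a (ps_hom S i j)"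
    by (simp add: circ_sgrp_def sg_restrict_def)
  \<comment> \<open>\<open>circ_sgrp\<close> is by construction the restriction whose regularity is
    already part of \<open>regular_subsemigroup\<close>.\<close>
  have "regular_semigroup (circ_sgrp S i j a b)"
    using regular_subsemigroup_circ by (simp add: circ_sgrp_def regular_subsemigroup_def)
  then show ?thesis
    unfolding circ
    using Reg_sandwich regular_subsemigroup_sandwich Reg_right regular_subsemigroup_right
      Reg_left regular_subsemigroup_left aPa_eq regular_subsemigroup_circ
    by blast
qed

end
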